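(* For every $n\in\mathbb{N}$ and every $P\in\mathcal{P}(\mathbb{C}^n)$ with $m=\deg_\infty(P)\ge 1$ we have $$\|P\|_{L_{\psi_{1/m}}(\mathbb{T}^n)}\le\big(2^n(e-1)\big)^m\,M(P).$$
   Context: $\mathcal{P}(\mathbb{C}^n)$ is the space of all polynomials $P(z)=\sum_\alpha c_\alpha(P)z^\alpha$ on $\mathbb{C}^n$ (finite sum over $\alpha\in\mathbb{N}_0^n$). $\deg_\infty(P)=\max_{1\le j\le n}\max\{\alpha_j : c_\alpha(P)\neq0\}$ is the maximal degree of $P$ in the individual variables. $\mathbb{T}^n=\{z\in\mathbb{C}^n:|z_1|=\dots=|z_n|=1\}$ carries the normalized Lebesgue (Haar probability) measure $dz$. The Mahler measure of $P\ne0$ is $M(P)=\exp\int_{\mathbb{T}^n}\log|P|\,dz$. For $\alpha>0$, $\psi_\alpha(t)=\exp(t^\alpha)-1$, $t\ge0$, and $$\|f\|_{L_{\psi_\alpha}(\mathbb{T}^n)}=\inf\Big\{\lambda>0 : \int_{\mathbb{T}^n}\psi_\alpha\Big(\frac{|f|}{\lambda}\Big)dz\le1\Big\}.$$ (This formula is used also when $\psi_\alpha$ is not convex.) *)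

theory Defs
  imports "HOL-Probability.Probability" "HOL-Library.Poly_Mapping"
begin

text \<open>
  Polynomials are finitely supported maps from exponent vectors to coefficients, so that
  \<^term>\<open>Poly_Mapping.lookup P \<alpha>\<close> is the coefficient of the monomial with exponents \<open>\<alpha>\<close>.
  Variables are indexed from 0: a polynomial in \<open>n\<close> variables uses the indices below \<open>n\<close> only.
\<close>

type_synonym cpoly = "(nat \<Rightarrow>\<^sub>0 nat) \<Rightarrow>\<^sub>0 complex"

definition polys :: "nat \<Rightarrow> cpoly set" where
  "polys n = {P. \<forall>\<alpha>\<in>Poly_Mapping.keys P. Poly_Mapping.keys \<alpha> \<subseteq> {..<n}}"

definition eval_poly :: "nat \<Rightarrow> cpoly \<Rightarrow> (nat \<Rightarrow> complex) \<Rightarrow> complex" where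
  "eval_poly n P z =
     (\<Sum>\<alpha>\<in>Poly_Mapping.keys P. Poly_Mapping.lookup P \<alpha> * (\<Prod>j<n. z j ^ Poly_Mapping.lookup \<alpha> j))"

text \<open>The inserted 0 only matters for the zero polynomial and for \<open>n = 0\<close>, where the maximum
  would range over the empty set.\<close>

definition deg_infty :: "nat \<Rightarrow> cpoly \<Rightarrow> nat" where
  "deg_infty n P =
     Max (insert 0 {Poly_Mapping.lookup \<alpha> j | j \<alpha>. j < n \<and> \<alpha> \<in> Poly_Mapping.keys P})"

definition circle_measure :: "complex measure" where
  "circle_measure =
     distr (uniform_measure lborel {0..2 * pi}) (restrict_space borel (sphere 0 1)) cis"

definition torus_measure :: "nat \<Rightarrow> (nat \<Rightarrow> complex) measure" where
  "torus_measure n = Pi\<^sub>M {..<n} (\<lambda>_. circle_measure)"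

text \<open>For a nonzero polynomial the zero set on the torus is a null set, so the convention
  \<^prop>\<open>ln 0 = (0::real)\<close> does not affect the integral.\<close>

definition mahler_measure :: "nat \<Rightarrow> cpoly \<Rightarrow> real" where
  "mahler_measure n P = exp (\<integral>z. ln (cmod (eval_poly n P z)) \<partial>torus_measure n)"

definition psi :: "real \<Rightarrow> real \<Rightarrow> real" where
  "psi \<alpha> t = exp (t powr \<alpha>) - 1"

text \<open>The integral and the infimum are taken in \<^typ>\<open>ennreal\<close>, so that a divergent integral counts
  as \<open>\<infinity>\<close> and the infimum of the empty set is \<open>\<infinity>\<close>.\<close>

definition orlicz_psi_norm :: "'a measure \<Rightarrow> real \<Rightarrow> ('a \<Rightarrow> complex) \<Rightarrow> ennreal" where
  "orlicz_psi_norm M \<alpha> f =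
     Inf {ennreal s | s. s > 0 \<and> (\<integral>\<^sup>+z. ennreal (psi \<alpha> (cmod (f z) / s)) \<partial>M) \<le> 1}"

lemma cis_measurable:
  "cis \<in> measurable (uniform_measure lborel {0..2 * pi}) (restrict_space borel (sphere 0 1))"
proof -
  have "cis \<in> borel_measurable borel"
    by (intro borel_measurable_continuous_onI continuous_intros)
  then have "cis \<in> measurable (uniform_measure lborel {0..2 * pi}) borel"
    by (simp add: measurable_def)
  then show ?thesis
    by (intro measurable_restrict_space2) auto
qed

lemma prob_space_circle_measure: "prob_space circle_measure"
proof -
  have "prob_space (uniform_measure lborel {0..2 * pi})"
    by (rule prob_space_uniform_measure) auto
  then show ?thesis
    unfolding circle_measure_def by (rule prob_space.prob_space_distr[OF _ cis_measurable])
qed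

lemma prob_space_torus_measure: "prob_space (torus_measure n)"
  unfolding torus_measure_def by (intro prob_space_PiM prob_space_circle_measure)

lemma space_torus_measure: "space (torus_measure n) = {..<n} \<rightarrow>\<^sub>E sphere 0 1"
  by (simp add: torus_measure_def space_PiM circle_measure_def space_restrict_space)

end

theory Submission
  imports Defs
    "HOL-Complex_Analysis.Cauchy_Integral_Formula"
    "HOL-Computational_Algebra.Fundamental_Theorem_Algebra"
    "HOL-Real_Asymp.Real_Asymp"
begin

text \<open>
  On the torus \<open>|P| \<le> 2^(n m) M(P)\<close> pointwise, so \<open>(|P| / \<lambda>)^(1/m) \<le> 1 / (e - 1) \<le> 2 / 3 \<le> ln 2\<close> for
  \<open>\<lambda> = (2^n (e - 1))^m M(P)\<close>, and the Orlicz integrand is at most \<open>1\<close> everywhere. In one variable the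
  pointwise bound comes from reflecting the roots in the unit disc, which leaves \<open>|P|\<close> unchanged on
  the circle, and from the mean value property of \<open>ln |P|\<close>. The truncation \<open>ln (max |P| e)\<close> satisfies
  the same bound and is bounded, even when a slice of \<open>P\<close> vanishes identically; so it can be iterated
  over the variables by Fubini, and \<open>e \<rightarrow> 0\<close> at the end.
\<close>

section \<open>The unit circle and the mean value property\<close>

lemma space_circle_measure: "space circle_measure = sphere 0 1"
  by (simp add: circle_measure_def space_restrict_space)

lemma continuous_on_sphere_circle_measurable:
  fixes f :: "complex \<Rightarrow> 'a::topological_space"
  assumes "continuous_on (sphere 0 1) f"
  shows "f \<in> borel_measurable circle_measure"
  using borel_measurable_continuous_on_restrict[OF assms]
  by (simp add: circle_measure_def measurable_def)

lemma integral_circle_measure: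
  fixes f :: "complex \<Rightarrow> real"
  assumes "f \<in> borel_measurable circle_measure"
  shows "(\<integral>x. f x \<partial>circle_measure) = (LBINT t:{0..2 * pi}. f (cis t)) / (2 * pi)"
proof -
  \<comment> \<open>The density is put in real-valued form, so that the Bochner integral can be
    transferred to \<open>lborel\<close>.\<close>
  have U: "uniform_measure lborel {0..2 * pi} =
      density lborel (\<lambda>x. ennreal (indicator {0..2 * pi} x / (2 * pi)))"
    unfolding uniform_measure_def
    by (rule density_cong) (auto simp: indicator_def divide_ennreal[symmetric] ennreal_1[symmetric] simp del: ennreal_1)
  have f: "f \<in> borel_measurable (restrict_space borel (sphere 0 1))"
    using assms by (simp add: circle_measure_def)
  have fc: "(\<lambda>x. f (cis x)) \<in> borel_measurable borel"
    using measurable_compose[OF cis_measurable f] by (simp add: measurable_def)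
  have "(\<integral>x. f x \<partial>circle_measure) = (\<integral>x. f (cis x) \<partial>uniform_measure lborel {0..2 * pi})"
    unfolding circle_measure_def by (rule integral_distr[OF cis_measurable f])
  also have "\<dots> = (\<integral>x. (indicator {0..2 * pi} x / (2 * pi)) *\<^sub>R f (cis x) \<partial>lborel)"
    unfolding U by (rule integral_density) (use fc in auto)
  also have "\<dots> = (\<integral>x. (indicator {0..2 * pi} x * f (cis x)) / (2 * pi) \<partial>lborel)"
    by simp
  also have "\<dots> = (LBINT t:{0..2 * pi}. f (cis t)) / (2 * pi)"
    by (simp add: set_lebesgue_integral_def)
  finally show ?thesis .
qed

text \<open>Cauchy's integral formula at the centre: with \<open>w = cis t\<close>, the factor
  \<open>\<i> * cis t\<close> of \<open>dw\<close> cancels the kernel \<open>1 / w\<close>. The real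
  part is the form needed for \<open>ln |q| = Re g\<close> when \<open>q = exp g\<close>.\<close>

lemma mean_value_circle_Re:
  assumes holo: "f holomorphic_on ball 0 R" and R: "1 < R"
  shows "(\<integral>x. Re (f x) \<partial>circle_measure) = Re (f 0)"
proof -
  have sub: "cball 0 1 \<subseteq> ball (0::complex) R" using R by auto
  have contf: "continuous_on (cball 0 1) f"
    using holo sub holomorphic_on_imp_continuous_on continuous_on_subset by blast
  have "((\<lambda>u. f u / (u - 0)) has_contour_integral (2 * of_real pi * \<i> * f 0)) (circlepath 0 1)"
    by (rule Cauchy_integral_circlepath_simple) (use holo sub holomorphic_on_subset in auto)
  then have "((\<lambda>t. f (cis t) / cis t * \<i> * cis t) has_integral (2 * of_real pi * \<i> * f 0)) {0..2 * pi}"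
    by (simp add: circlepath_def has_contour_integral_part_circlepath_iff)
  then have "((\<lambda>t. \<i> * f (cis t)) has_integral (2 * of_real pi * \<i> * f 0)) {0..2 * pi}"
    by (simp add: mult.commute)
  from has_integral_mult_right[OF this, of "-\<i>"]
  have "((\<lambda>t. f (cis t)) has_integral (2 * of_real pi * f 0)) {0..2 * pi}"
    by (simp add: algebra_simps)
  from has_integral_linear[OF this bounded_linear_Re]
  have I: "((\<lambda>t. Re (f (cis t))) has_integral (2 * pi * Re (f 0))) {0..2 * pi}"
    by (simp add: o_def)
  have cs: "continuous_on (sphere 0 1) (\<lambda>x. Re (f x))"
    by (intro continuous_intros continuous_on_subset[OF contf]) auto
  have "continuous_on {0..2 * pi} (\<lambda>t. Re (f (cis t)))"
    by (rule continuous_on_compose2[OF cs]) (auto intro!: continuous_intros)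
  then have "set_integrable lborel {0..2 * pi} (\<lambda>t. Re (f (cis t)))"
    unfolding set_integrable_def by (intro borel_integrable_compact) auto
  from set_borel_integral_eq_integral(2)[OF this]
  have "(LBINT t:{0..2 * pi}. Re (f (cis t))) = 2 * pi * Re (f 0)"
    using I by (simp add: integral_unique)
  then show ?thesis
    by (simp add: integral_circle_measure continuous_on_sphere_circle_measurable[OF cs])
qed

section \<open>One variable: truncated Jensen inequality and reflection of roots\<close>

text \<open>On circles of radius \<open>r < 1\<close> this is the mean value property of the harmonic function
  \<open>ln |q|\<close>; the truncation at \<open>e\<close> makes the limit \<open>r \<rightarrow> 1\<close> harmless when \<open>q\<close> has zeros on the circle.\<close>

lemma ln_le_integral_ln_max:
  fixes q :: "complex poly"
  assumes nz: "\<And>w. cmod w < 1 \<Longrightarrow> poly q w \<noteq> 0" and e: "0 < e"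
  shows "ln (cmod (poly q 0)) \<le> (\<integral>w. ln (max (cmod (poly q w)) e) \<partial>circle_measure)"
proof -
  interpret prob_space circle_measure by (rule prob_space_circle_measure)
  \<comment> \<open>Radii strictly below 1 that tend to 1; the shift by 2 keeps \<open>r 0\<close>
    positive.\<close>
  define r where "r = (\<lambda>k::nat. 1 - inverse (real (k + 2)))"
  have r: "0 < r k" "r k < 1" for k
    by (auto simp: r_def field_simps)
  have rlim: "r \<longlonglongrightarrow> 1"
    unfolding r_def by real_asymp
  have bnd: "bounded (poly q ` cball 0 1)"
    by (intro compact_imp_bounded compact_continuous_image continuous_intros) auto
  then obtain B where B: "\<forall>w\<in>cball 0 1. cmod (poly q w) \<le> B"
    unfolding bounded_iff by auto
  \<comment> \<open>The truncated logarithm lies between \<open>ln e\<close> and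
    \<open>ln (max B e)\<close> on the closed disc, so one constant dominates it for all radii at
    once.\<close>
  define C where "C = \<bar>ln e\<bar> + \<bar>ln (max B e)\<bar>"
  have C: "\<bar>ln (max (cmod (poly q w)) e)\<bar> \<le> C" if "w \<in> cball 0 1" for w
  proof -
    have "ln e \<le> ln (max (cmod (poly q w)) e)" using e by simp
    moreover have "ln (max (cmod (poly q w)) e) \<le> ln (max B e)"
      using e B that by (intro ln_mono max.mono) auto
    ultimately show ?thesis unfolding C_def by linarith
  qed
  have cont: "continuous_on (sphere 0 1) (\<lambda>w. ln (max (cmod (poly q (c * w))) e))" for c
    by (intro continuous_intros) (use e in \<open>auto simp: max_def\<close>)
  have meas: "(\<lambda>w. ln (max (cmod (poly q (c * w))) e)) \<in> borel_measurable circle_measure" for c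
    by (rule continuous_on_sphere_circle_measurable[OF cont])
  have int: "integrable circle_measure (\<lambda>w. ln (max (cmod (poly q (of_real (r k) * w))) e))" for k
    by (rule integrable_const_bound[of _ C, OF AE_I2 meas])
      (use r[of k] C in \<open>auto simp: space_circle_measure norm_mult\<close>)
  have ineq: "ln (cmod (poly q 0)) \<le> (\<integral>w. ln (max (cmod (poly q (of_real (r k) * w))) e) \<partial>circle_measure)" for k
  proof -
    \<comment> \<open>Scaling the argument by \<open>r k\<close> pushes the zeros out of the disc of
      radius \<open>1 / r k > 1\<close>. This disc is convex, so a holomorphic logarithm
      \<open>g\<close> exists beyond the unit circle.\<close>
    have nz': "poly q (of_real (r k) * w) \<noteq> 0" if "w \<in> ball 0 (1 / r k)" for w
      using nz[of "of_real (r k) * w"] that r[of k] by (simp add: norm_mult field_simps)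
    have "(\<lambda>w. poly q (of_real (r k) * w)) holomorphic_on ball 0 (1 / r k)"
      by (intro holomorphic_intros)
    then obtain g where g: "g holomorphic_on ball 0 (1 / r k)"
        "\<And>z. z \<in> ball 0 (1 / r k) \<Longrightarrow> poly q (of_real (r k) * z) = exp (g z)"
      by (rule contractible_imp_holomorphic_log) (use nz' in \<open>auto intro: convex_imp_contractible\<close>)
    have g0: "cmod (poly q 0) = exp (Re (g 0))"
      using g(2)[of 0] r[of k] by simp
    have R1: "1 < 1 / r k" using r[of k] by simp
    have cg: "continuous_on (sphere 0 1) (\<lambda>x. Re (g x))"
      by (intro continuous_intros continuous_on_subset[OF holomorphic_on_imp_continuous_on[OF g(1)]])
        (use R1 in auto)
    have "bounded ((\<lambda>x. Re (g x)) ` sphere 0 1)"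
      by (intro compact_imp_bounded compact_continuous_image cg) auto
    then obtain D where D: "\<forall>x\<in>sphere 0 1. \<bar>Re (g x)\<bar> \<le> D"
      unfolding bounded_iff by auto
    have ig: "integrable circle_measure (\<lambda>x. Re (g x))"
      by (rule integrable_const_bound[of _ D, OF AE_I2 continuous_on_sphere_circle_measurable[OF cg]])
        (use D in \<open>auto simp: space_circle_measure\<close>)
    have "ln (cmod (poly q 0)) = (\<integral>x. Re (g x) \<partial>circle_measure)"
      using mean_value_circle_Re[OF g(1) R1] g0 by simp
    also have "\<dots> \<le> (\<integral>w. ln (max (cmod (poly q (of_real (r k) * w))) e) \<partial>circle_measure)"
    proof (rule integral_mono[OF ig int])
      fix x assume "x \<in> space circle_measure"
      then have "cmod (poly q (of_real (r k) * x)) = exp (Re (g x))"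
        using g(2)[of x] R1 by (simp add: space_circle_measure)
      then have "Re (g x) = ln (cmod (poly q (of_real (r k) * x)))" "0 < cmod (poly q (of_real (r k) * x))"
        by simp_all
      then show "Re (g x) \<le> ln (max (cmod (poly q (of_real (r k) * x))) e)"
        by (metis ln_mono max.cobounded1)
    qed
    finally show ?thesis .
  qed
  have "(\<lambda>k. \<integral>w. ln (max (cmod (poly q (of_real (r k) * w))) e) \<partial>circle_measure)
      \<longlonglongrightarrow> (\<integral>w. ln (max (cmod (poly q w)) e) \<partial>circle_measure)"
  proof (rule integral_dominated_convergence[where w = "\<lambda>_. C"])
    show "(\<lambda>w. ln (max (cmod (poly q w)) e)) \<in> borel_measurable circle_measure"
      using meas[of 1] by simp
    show "AE x in circle_measure. (\<lambda>k. ln (max (cmod (poly q (of_real (r k) * x))) e))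
        \<longlonglongrightarrow> ln (max (cmod (poly q x)) e)"
    proof (rule AE_I2)
      fix x :: complex
      have "(\<lambda>k. of_real (r k) * x) \<longlonglongrightarrow> of_real 1 * x"
        by (intro tendsto_intros rlim)
      then have "(\<lambda>k. of_real (r k) * x) \<longlonglongrightarrow> x" by simp
      then show "(\<lambda>k. ln (max (cmod (poly q (of_real (r k) * x))) e)) \<longlonglongrightarrow> ln (max (cmod (poly q x)) e)"
        by (intro tendsto_ln tendsto_max tendsto_norm tendsto_poly tendsto_const) (use e in \<open>auto simp: max_def\<close>)
    qed
    show "AE x in circle_measure. norm (ln (max (cmod (poly q (of_real (r k) * x))) e)) \<le> C" for k
      by (rule AE_I2) (use r[of k] C in \<open>auto simp: space_circle_measure norm_mult\<close>)
  qed (use meas in auto)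
  then show ?thesis
    by (rule LIMSEQ_le_const) (use ineq in auto)
qed

text \<open>Each root \<open>a\<close> inside the unit disc is reflected: \<open>w - a\<close> becomes \<open>1 - cnj a * w\<close>, which has
  the same modulus on the unit circle.\<close>

lemma reflect_roots:
  fixes p :: "complex poly"
  assumes "p \<noteq> 0" "degree p \<le> m"
  obtains q where "\<And>w. cmod w = 1 \<Longrightarrow> cmod (poly q w) = cmod (poly p w)"
    and "\<And>w. cmod w < 1 \<Longrightarrow> poly q w \<noteq> 0"
    and "\<And>w. cmod w = 1 \<Longrightarrow> cmod (poly p w) \<le> 2 ^ m * cmod (poly q 0)"
proof -
  have "\<exists>q. (\<forall>w. cmod w = 1 \<longrightarrow> cmod (poly q w) = cmod (poly p w)) \<and>
      (\<forall>w. cmod w < 1 \<longrightarrow> poly q w \<noteq> 0) \<and>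
      (\<forall>w. cmod w = 1 \<longrightarrow> cmod (poly p w) \<le> 2 ^ m * cmod (poly q 0))"
    using assms
  proof (induction m arbitrary: p)
    case 0
    then obtain c where "p = [:c:]" "c \<noteq> 0"
      by (metis degree_eq_zeroE le_zero_eq pCons_0_0)
    then show ?case by (intro exI[of _ p]) auto
  next
    case (Suc m)
    show ?case
    \<comment> \<open>\<open>m\<close> only bounds the degree, so a constant polynomial may occur at
      any stage of the induction.\<close>
    proof (cases "degree p = 0")
      case True
      then obtain c where c: "p = [:c:]" "c \<noteq> 0"
        using Suc.prems(1) by (metis degree_eq_zeroE pCons_0_0)
      have "cmod c \<le> 2 ^ Suc m * cmod c"
        using mult_right_mono[of 1 "2 ^ Suc m" "cmod c"] one_le_power[of "2::real" "Suc m"] by simp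
      with c show ?thesis by (intro exI[of _ p]) auto
    next
      case False
      then obtain a where "poly p a = 0"
        using fundamental_theorem_of_algebra_alt[of p] by (metis degree_pCons_0)
      then obtain p' where p': "p = [:-a, 1:] * p'"
        by (metis poly_eq_0_iff_dvd dvdE)
      have pw: "cmod (poly p w) = cmod (w - a) * cmod (poly p' w)" for w
        by (simp add: p' algebra_simps flip: norm_mult)
      have "p' \<noteq> 0" using Suc.prems p' by auto
      moreover have "degree p' \<le> m"
        using Suc.prems(2) \<open>p' \<noteq> 0\<close> unfolding p' by (subst (asm) degree_mult_eq) auto
      ultimately obtain q' where
        q1: "\<And>w. cmod w = 1 \<Longrightarrow> cmod (poly q' w) = cmod (poly p' w)" and
        q2: "\<And>w. cmod w < 1 \<Longrightarrow> poly q' w \<noteq> 0" and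
        q3: "\<And>w. cmod w = 1 \<Longrightarrow> cmod (poly p' w) \<le> 2 ^ m * cmod (poly q' 0)"
        using Suc.IH[of p'] by blast
      \<comment> \<open>A root with \<open>cmod a \<ge> 1\<close> already lies outside the open
        disc, so its factor is kept. In both cases \<open>cmod (poly l 0)\<close> is the larger of 1
        and \<open>cmod a\<close>.\<close>
      define l where "l = (if cmod a < 1 then [:1, - cnj a:] else [:-a, 1:])"
      have l1: "cmod (poly l w) = cmod (w - a)" if w: "cmod w = 1" for w
      proof (cases "cmod a < 1")
        case True
        have "w * cnj w = 1" using w by (simp add: complex_norm_square[symmetric])
        then have "1 - cnj a * w = w * cnj (w - a)" by (simp add: algebra_simps)
        then have "cmod (1 - cnj a * w) = cmod (w - a)"
          using w by (metis complex_mod_cnj mult_1 norm_mult)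
        with True show ?thesis by (simp add: l_def mult.commute)
      qed (simp add: l_def)
      have l2: "poly l w \<noteq> 0" if w: "cmod w < 1" for w
      proof (cases "cmod a < 1")
        case True
        have "cmod (w * cnj a) < 1"
          using mult_strict_mono'[of "cmod w" 1 "cmod a" 1] True w by (simp add: norm_mult)
        then have "w * cnj a \<noteq> 1" by auto
        with True show ?thesis by (auto simp: l_def)
      next
        case False
        with w show ?thesis by (auto simp: l_def)
      qed
      \<comment> \<open>Source of the factor 2 per degree: \<open>1 + cmod a\<close> is at most
        twice the larger of 1 and \<open>cmod a\<close>.\<close>
      have l3: "cmod (w - a) \<le> 2 * cmod (poly l 0)" if w: "cmod w = 1" for w
        using norm_triangle_ineq4[of w a] w by (auto simp: l_def)
      show ?thesis
      proof (intro exI[of _ "l * q'"] conjI allI impI)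
        fix w :: complex assume w: "cmod w = 1"
        show "cmod (poly (l * q') w) = cmod (poly p w)"
          using l1[OF w] q1[OF w] by (simp add: pw norm_mult)
        have "cmod (w - a) * cmod (poly p' w) \<le> (2 * cmod (poly l 0)) * (2 ^ m * cmod (poly q' 0))"
          by (intro mult_mono l3 q3 w) auto
        then show "cmod (poly p w) \<le> 2 ^ Suc m * cmod (poly (l * q') 0)"
          by (simp add: pw norm_mult mult_ac)
      next
        fix w :: complex assume w: "cmod w < 1"
        show "poly (l * q') w \<noteq> 0" using l2[OF w] q2[OF w] by simp
      qed
    qed
  qed
  then show ?thesis using that by blast
qed

text \<open>Truncating both sides lets the estimate cover \<open>p = 0\<close>. Where
  \<open>cmod (poly p z) < e\<close> the left side is \<open>ln e\<close>, a lower bound of the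
  integrand. Otherwise the reflected polynomial \<open>q\<close> applies:
  \<open>ln (cmod (poly q 0))\<close> is below a circle mean in which \<open>q\<close> and
  \<open>p\<close> agree in modulus.\<close>

lemma ln_max_poly_le:
  fixes p :: "complex poly"
  assumes deg: "degree p \<le> m" and z: "cmod z = 1" and e: "0 < e"
  shows "ln (max (cmod (poly p z)) e)
    \<le> real m * ln 2 + (\<integral>w. ln (max (cmod (poly p w)) e) \<partial>circle_measure)"
proof -
  interpret prob_space circle_measure by (rule prob_space_circle_measure)
  have cont: "continuous_on (sphere 0 1) (\<lambda>w. ln (max (cmod (poly p w)) e))"
    by (intro continuous_intros) (use e in \<open>auto simp: max_def\<close>)
  have "bounded ((\<lambda>w. ln (max (cmod (poly p w)) e)) ` sphere 0 1)"
    by (intro compact_imp_bounded compact_continuous_image cont) auto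
  then obtain D where D: "\<forall>w\<in>sphere 0 1. \<bar>ln (max (cmod (poly p w)) e)\<bar> \<le> D"
    unfolding bounded_iff by auto
  have "integrable circle_measure (\<lambda>w. ln (max (cmod (poly p w)) e))"
    by (rule integrable_const_bound[of _ D, OF AE_I2 continuous_on_sphere_circle_measurable[OF cont]])
      (use D in \<open>auto simp: space_circle_measure\<close>)
  then have lower: "ln e \<le> (\<integral>w. ln (max (cmod (poly p w)) e) \<partial>circle_measure)"
    by (rule integral_ge_const) (use e in auto)
  show ?thesis
  proof (cases "e \<le> cmod (poly p z)")
    case False
    then have "max (cmod (poly p z)) e = e" by simp
    moreover have "0 \<le> real m * ln 2" by simp
    ultimately show ?thesis using lower by linarith
  next
    case True
    then have "p \<noteq> 0" using e by auto
    then obtain q where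
      q1: "\<And>w. cmod w = 1 \<Longrightarrow> cmod (poly q w) = cmod (poly p w)" and
      q2: "\<And>w. cmod w < 1 \<Longrightarrow> poly q w \<noteq> 0" and
      q3: "\<And>w. cmod w = 1 \<Longrightarrow> cmod (poly p w) \<le> 2 ^ m * cmod (poly q 0)"
      using reflect_roots[OF _ deg] by blast
    have q0: "0 < cmod (poly q 0)" using q2[of 0] by simp
    have "ln (max (cmod (poly p z)) e) = ln (cmod (poly p z))" using True by simp
    also have "\<dots> \<le> ln (2 ^ m * cmod (poly q 0))"
      using q3[OF z] True e by (intro ln_mono) auto
    also have "\<dots> = real m * ln 2 + ln (cmod (poly q 0))"
      using q0 by (subst ln_mult) (auto simp: ln_realpow)
    also have "ln (cmod (poly q 0)) \<le> (\<integral>w. ln (max (cmod (poly q w)) e) \<partial>circle_measure)"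
      by (rule ln_le_integral_ln_max[OF q2 e])
    also have "(\<integral>w. ln (max (cmod (poly q w)) e) \<partial>circle_measure)
        = (\<integral>w. ln (max (cmod (poly p w)) e) \<partial>circle_measure)"
      by (rule Bochner_Integration.integral_cong) (auto simp: space_circle_measure q1)
    finally show ?thesis by simp
  qed
qed

section \<open>Iteration over the variables\<close>

text \<open>Induction on \<open>I\<close>: the one-variable bound in the new coordinate, the
  induction hypothesis under the integral, then Fubini; each coordinate costs
  \<open>m * ln 2\<close>. \<open>F\<close> is described by its slices because this class is closed
  under freezing a coordinate, as the induction requires.\<close>

lemma ln_max_le_integral_PiM:
  fixes F :: "('i \<Rightarrow> complex) \<Rightarrow> complex"
  assumes "finite I" and e: "0 < e"
    and "F \<in> borel_measurable (\<Pi>\<^sub>M j\<in>I. circle_measure)"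
    and "\<And>x. x \<in> I \<rightarrow>\<^sub>E sphere 0 1 \<Longrightarrow> cmod (F x) \<le> B"
    and "\<And>x j. j \<in> I \<Longrightarrow> \<exists>p. degree p \<le> m \<and> (\<forall>w. F (x(j := w)) = poly p w)"
    and "z \<in> I \<rightarrow>\<^sub>E sphere 0 1"
  shows "ln (max (cmod (F z)) e) \<le> real (card I) * (real m * ln 2)
    + (\<integral>x. ln (max (cmod (F x)) e) \<partial>(\<Pi>\<^sub>M j\<in>I. circle_measure))"
  using assms(1,3-)
proof (induction I arbitrary: F z rule: finite_induct)
  case empty
  \<comment> \<open>The empty product is a one-point space, so the integral is the value at
    \<open>z\<close>.\<close>
  then show ?case by (simp add: PiM_empty lebesgue_integral_count_space_finite)
next
  case (insert i I)
  let ?C = "\<lambda>_. circle_measure"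
  define G where "G = (\<lambda>x. ln (max (cmod (F x)) e))"
  define C where "C = \<bar>ln e\<bar> + \<bar>ln (max B e)\<bar>"
  interpret product_sigma_finite ?C
    by (intro product_sigma_finite.intro prob_space_imp_sigma_finite prob_space_circle_measure)
  interpret P: prob_space "Pi\<^sub>M I ?C"
    by (intro prob_space_PiM prob_space_circle_measure)
  interpret Ci: prob_space circle_measure by (rule prob_space_circle_measure)
  interpret PC: pair_prob_space "Pi\<^sub>M I ?C" circle_measure ..
  interpret Q: prob_space "Pi\<^sub>M (insert i I) ?C"
    by (intro prob_space_PiM prob_space_circle_measure)
  have upd: "x(i := w) \<in> insert i I \<rightarrow>\<^sub>E sphere 0 1"
    if "x \<in> I \<rightarrow>\<^sub>E sphere 0 1" "cmod w = 1" for x w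
    using that by (auto simp: PiE_def extensional_def)
  have GC: "\<bar>G x\<bar> \<le> C" if "x \<in> insert i I \<rightarrow>\<^sub>E sphere 0 1" for x
  proof -
    have "ln e \<le> G x" using e by (simp add: G_def)
    moreover have "G x \<le> ln (max B e)"
      unfolding G_def using e insert.prems(2)[OF that] by (intro ln_mono max.mono) auto
    ultimately show ?thesis unfolding C_def by linarith
  qed
  note [measurable] = insert.prems(1)
  have G[measurable]: "G \<in> borel_measurable (Pi\<^sub>M (insert i I) ?C)"
    unfolding G_def by measurable
  have G2[measurable]: "(\<lambda>(x, w). G (x(i := w))) \<in> borel_measurable (Pi\<^sub>M I ?C \<Otimes>\<^sub>M circle_measure)"
    using measurable_compose[OF measurable_add_dim[of i I ?C] G] by (simp add: case_prod_beta')
  have int2: "integrable (Pi\<^sub>M I ?C \<Otimes>\<^sub>M circle_measure) (\<lambda>(x, w). G (x(i := w)))"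
    by (rule PC.integrable_const_bound[of _ C, OF AE_I2 G2])
      (auto simp: space_pair_measure space_PiM space_circle_measure intro!: GC upd)
  have intG: "integrable (Pi\<^sub>M (insert i I) ?C) G"
    by (rule Q.integrable_const_bound[of _ C, OF AE_I2 G])
      (auto simp: space_PiM space_circle_measure intro!: GC)
  \<comment> \<open>The product spaces over \<open>I\<close> and \<open>insert i I\<close> fix
    undefined values outside different index sets, so \<open>z\<close> is split into an extensional
    point over \<open>I\<close> and its coordinate \<open>i\<close>.\<close>
  define x0 where "x0 = restrict z I"
  have x0: "x0 \<in> I \<rightarrow>\<^sub>E sphere 0 1"
    using insert.prems(4) by (auto simp: x0_def)
  have z: "z = x0(i := z i)" and zi: "cmod (z i) = 1"
    using insert.prems(4) by (auto simp: x0_def fun_eq_iff PiE_def extensional_def)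
  \<comment> \<open>The induction hypothesis is used for the slice at every \<open>w\<close>, always
    at the point \<open>x0\<close>.\<close>
  have IH: "G (x0(i := w)) \<le> real (card I) * (real m * ln 2) + (\<integral>x. G (x(i := w)) \<partial>Pi\<^sub>M I ?C)"
    if w: "w \<in> space circle_measure" for w
    unfolding G_def
  proof (rule insert.IH[OF _ _ _ x0])
    show "(\<lambda>x. F (x(i := w))) \<in> borel_measurable (Pi\<^sub>M I ?C)"
      using w by measurable
    show "cmod (F (x(i := w))) \<le> B" if "x \<in> I \<rightarrow>\<^sub>E sphere 0 1" for x
      by (rule insert.prems(2)[OF upd[OF that]]) (use w in \<open>simp add: space_circle_measure\<close>)
    show "\<exists>p. degree p \<le> m \<and> (\<forall>u. F ((x(j := u))(i := w)) = poly p u)" if "j \<in> I" for x j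
    proof -
      have "j \<noteq> i" using that insert.hyps by auto
      then have *: "(x(j := u))(i := w) = (x(i := w))(j := u)" for u
        by (rule fun_upd_twist)
      show ?thesis
        unfolding * by (rule insert.prems(3)) (use that in simp)
    qed
  qed
  obtain p where p: "degree p \<le> m" "\<And>w. F (x0(i := w)) = poly p w"
    using insert.prems(3)[of i x0] by blast
  have m1: "(\<lambda>w. G (x0(i := w))) \<in> borel_measurable circle_measure"
    using measurable_compose[OF measurable_component_update[of x0 I ?C i] G] x0 insert.hyps
    by (simp add: space_PiM space_circle_measure)
  have int1: "integrable circle_measure (\<lambda>w. G (x0(i := w)))"
    by (rule Ci.integrable_const_bound[of _ C, OF AE_I2 m1])
      (auto simp: space_circle_measure intro!: GC upd x0)
  have "G z \<le> real m * ln 2 + (\<integral>w. G (x0(i := w)) \<partial>circle_measure)"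
    using ln_max_poly_le[OF p(1) zi e] by (subst z) (simp add: G_def p(2))
  also have "(\<integral>w. G (x0(i := w)) \<partial>circle_measure)
      \<le> (\<integral>w. real (card I) * (real m * ln 2) + (\<integral>x. G (x(i := w)) \<partial>Pi\<^sub>M I ?C) \<partial>circle_measure)"
    using PC.integrable_snd[OF int2] IH by (intro integral_mono int1) auto
  also have "\<dots> = real (card I) * (real m * ln 2) + (\<integral>w. (\<integral>x. G (x(i := w)) \<partial>Pi\<^sub>M I ?C) \<partial>circle_measure)"
    using PC.integrable_snd[OF int2] by (subst Bochner_Integration.integral_add) (auto simp: Ci.prob_space)
  also have "(\<integral>w. (\<integral>x. G (x(i := w)) \<partial>Pi\<^sub>M I ?C) \<partial>circle_measure)
      = (\<integral>x. (\<integral>w. G (x(i := w)) \<partial>circle_measure) \<partial>Pi\<^sub>M I ?C)"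
    by (rule PC.Fubini_integral[OF int2])
  also have "\<dots> = integral\<^sup>L (Pi\<^sub>M (insert i I) ?C) G"
    by (rule product_integral_insert[symmetric, OF insert.hyps intG])
  finally show ?case
    using insert.hyps by (simp add: G_def algebra_simps)
qed

section \<open>Removing the truncation\<close>

text \<open>Monotone convergence as the truncation level decreases to 0. Two default values need
  care: \<open>ln 0 = 0\<close>, and a non-integrable function has integral 0. The uniform bound
  \<open>A\<close> settles both: zeros of positive measure would drive the truncated integrals to
  minus infinity, and bounded monotone integrals force integrability of the limit.\<close>

lemma (in prob_space) le_integral_ln_of_truncated:
  fixes f :: "'a \<Rightarrow> real"
  assumes f[measurable]: "f \<in> borel_measurable M"
    and bd: "\<And>x. x \<in> space M \<Longrightarrow> 0 \<le> f x" "\<And>x. x \<in> space M \<Longrightarrow> f x \<le> B"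
    and A: "\<And>e. 0 < e \<Longrightarrow> A \<le> (\<integral>x. ln (max (f x) e) \<partial>M)"
  shows "A \<le> (\<integral>x. ln (f x) \<partial>M)"
proof -
  \<comment> \<open>With \<open>D \<ge> 1\<close>, \<open>ln D\<close> is nonnegative and
    \<open>D\<close> bounds \<open>e k\<close> as well as \<open>f\<close>, so \<open>ln D\<close>
    is above every \<open>X k\<close>.\<close>
  define D where "D = max B 1"
  have D: "1 \<le> D" "\<And>x. x \<in> space M \<Longrightarrow> f x \<le> D"
    using bd(2) unfolding D_def by (auto simp: le_max_iff_disj)
  define e where "e = (\<lambda>k::nat. inverse (real (Suc k)))"
  have e: "0 < e k" "e k \<le> 1" for k
    by (auto simp: e_def field_simps)
  have elim: "e \<longlonglongrightarrow> 0"
    unfolding e_def by (rule LIMSEQ_inverse_real_of_nat)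
  define X where "X = (\<lambda>k x. ln (max (f x) (e k)))"
  have X[measurable]: "X k \<in> borel_measurable M" for k
    unfolding X_def by measurable
  have XD: "X k x \<le> ln D" and Xe: "ln (e k) \<le> X k x" if "x \<in> space M" for k x
    unfolding X_def using e[of k] D that by (auto intro!: ln_mono order.trans[OF e(2)])
  have D0: "0 \<le> ln D" using D(1) by simp
  have intX: "integrable M (X k)" for k
  proof (rule integrable_const_bound[of _ "\<bar>ln (e k)\<bar> + \<bar>ln D\<bar>", OF AE_I2 X])
    fix x assume "x \<in> space M"
    then show "norm (X k x) \<le> \<bar>ln (e k)\<bar> + \<bar>ln D\<bar>"
      using XD[of x k] Xe[of x k] by auto
  qed
  define N where "N = {x \<in> space M. f x = 0}"
  have N[measurable]: "N \<in> sets M" unfolding N_def by measurable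
  have intN: "integrable M (\<lambda>x. indicator N x * ln (real (Suc k)))" for k
    by (intro integrable_mult_left integrable_real_indicator) (auto simp: emeasure_eq_measure)
  \<comment> \<open>On \<open>N\<close> the truncated value is exactly
    \<open>- ln (real (Suc k))\<close>; elsewhere only the bound \<open>ln D\<close> is
    used.\<close>
  have up: "A \<le> ln D - prob N * ln (real (Suc k))" for k
  proof -
    have "A \<le> integral\<^sup>L M (X k)" using A[OF e(1)] by (simp add: X_def)
    also have "\<dots> \<le> (\<integral>x. ln D - indicator N x * ln (real (Suc k)) \<partial>M)"
    proof (rule integral_mono[OF intX])
      fix x assume x: "x \<in> space M"
      show "X k x \<le> ln D - indicator N x * ln (real (Suc k))"
      proof (cases "x \<in> N")
        case True
        then have "X k x = - ln (real (Suc k))"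
          using e[of k] by (simp add: X_def N_def e_def ln_inverse max_def)
        with True D0 show ?thesis by simp
      next
        case False
        then show ?thesis using XD[OF x] by simp
      qed
    qed (intro Bochner_Integration.integrable_diff integrable_const intN)
    also have "\<dots> = ln D - prob N * ln (real (Suc k))"
      using intN[of k] by (subst Bochner_Integration.integral_diff) (auto simp: prob_space)
    finally show ?thesis .
  qed
  have "prob N = 0"
  proof (rule ccontr)
    assume "prob N \<noteq> 0"
    then have "0 < prob N" using measure_nonneg[of M N] by linarith
    moreover have "filterlim (\<lambda>k. ln (real (Suc k))) at_top sequentially"
      by real_asymp
    then obtain k where "(ln D - A) / prob N < ln (real (Suc k))"
      by (metis (mono_tags, lifting) eventually_sequentially filterlim_at_top_dense order_refl)
    ultimately have "ln D - A < prob N * ln (real (Suc k))"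
      by (simp add: field_simps)
    with up[of k] show False by simp
  qed
  \<comment> \<open>At a zero of \<open>f\<close> the values \<open>X k x\<close> diverge to minus
    infinity instead of tending to \<open>ln 0 = 0\<close>, so the pointwise convergence below is
    restricted to \<open>f x > 0\<close>.\<close>
  then have AEpos: "AE x in M. 0 < f x"
  proof -
    have "AE x in M. x \<notin> N"
      using \<open>prob N = 0\<close> by (intro AE_not_in) (simp add: null_sets_def emeasure_eq_measure)
    then show ?thesis
      by (rule AE_mp) (use bd(1) in \<open>force intro!: AE_I2 simp: N_def less_le\<close>)
  qed
  have decX: "X (Suc k) x \<le> X k x" for k x
    unfolding X_def using e[of "Suc k"]
    by (intro ln_mono max.mono) (auto simp: e_def field_simps less_max_iff_disj)
  \<comment> \<open>\<open>X\<close> decreases in \<open>k\<close>; after the change of sign the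
    integrals increase and stay below \<open>- A\<close>.\<close>
  define L where "L = (\<lambda>k. integral\<^sup>L M (\<lambda>x. - X k x))"
  have "incseq L"
    unfolding L_def using decX by (intro incseq_SucI integral_mono) (auto intro: intX)
  moreover have "L k \<le> - A" for k
    using A[OF e(1)] by (simp add: L_def X_def)
  ultimately obtain l where l: "L \<longlonglongrightarrow> l" "\<And>k. L k \<le> l"
    using incseq_convergent[of L "- A"] by auto
  have "integral\<^sup>L M (\<lambda>x. - ln (f x)) = l"
  proof (rule integral_monotone_convergence[where f = "\<lambda>k x. - X k x"])
    show "AE x in M. mono (\<lambda>k. - X k x)"
      using decX by (intro AE_I2 incseq_SucI) auto
    show "AE x in M. (\<lambda>k. - X k x) \<longlonglongrightarrow> - ln (f x)"
      using AEpos
    proof eventually_elim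
      fix x assume pos: "0 < f x"
      have "(\<lambda>k. max (f x) (e k)) \<longlonglongrightarrow> max (f x) 0"
        by (intro tendsto_max tendsto_const elim)
      then have "(\<lambda>k. max (f x) (e k)) \<longlonglongrightarrow> f x" using pos by (simp add: max_def)
      then show "(\<lambda>k. - X k x) \<longlonglongrightarrow> - ln (f x)"
        unfolding X_def using pos by (intro tendsto_intros) auto
    qed
    show "(\<lambda>k. \<integral>x. - X k x \<partial>M) \<longlonglongrightarrow> l" using l(1) by (simp add: L_def)
  qed (use intX in auto)
  moreover have "l \<le> - A"
    by (rule LIMSEQ_le_const2[OF l(1)]) (use A[OF e(1)] in \<open>auto simp: L_def X_def\<close>)
  ultimately show ?thesis by simp
qed

section \<open>Polynomials on the torus\<close>

text \<open>Supplies the slice hypothesis of the induction over the variables. The other coordinates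
  are absorbed into the coefficients, so only the exponent of variable \<open>j\<close> counts, and
  \<open>deg_infty\<close> bounds it.\<close>

lemma eval_poly_fun_upd_eq_poly:
  assumes "j < n"
  shows "\<exists>p. degree p \<le> deg_infty n P \<and> (\<forall>w. eval_poly n P (z(j := w)) = poly p w)"
proof -
  define c where "c = (\<lambda>\<alpha>. Poly_Mapping.lookup P \<alpha> * (\<Prod>i\<in>{..<n} - {j}. z i ^ Poly_Mapping.lookup \<alpha> i))"
  \<comment> \<open>Distinct exponent vectors may share the exponent of \<open>j\<close>, hence a
    sum of monomials rather than a list of coefficients.\<close>
  define p where "p = (\<Sum>\<alpha>\<in>Poly_Mapping.keys P. Polynomial.monom (c \<alpha>) (Poly_Mapping.lookup \<alpha> j))"
  have "{Poly_Mapping.lookup \<alpha> j | j \<alpha>. j < n \<and> \<alpha> \<in> Poly_Mapping.keys P}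
      = (\<lambda>(j, \<alpha>). Poly_Mapping.lookup \<alpha> j) ` ({..<n} \<times> Poly_Mapping.keys P)"
    by auto
  then have fin: "finite {Poly_Mapping.lookup \<alpha> j | j \<alpha>. j < n \<and> \<alpha> \<in> Poly_Mapping.keys P}"
    by simp
  have "Poly_Mapping.lookup \<alpha> j \<le> deg_infty n P" if "\<alpha> \<in> Poly_Mapping.keys P" for \<alpha>
    unfolding deg_infty_def using fin that assms by (intro Max_ge) auto
  then have "degree p \<le> deg_infty n P"
    unfolding p_def by (intro degree_sum_le) (auto intro: order.trans[OF degree_monom_le])
  moreover have "eval_poly n P (z(j := w)) = poly p w" for w
  proof -
    have "(\<Prod>i<n. (z(j := w)) i ^ Poly_Mapping.lookup \<alpha> i)
        = w ^ Poly_Mapping.lookup \<alpha> j * (\<Prod>i\<in>{..<n} - {j}. z i ^ Poly_Mapping.lookup \<alpha> i)" for \<alpha>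
      using assms by (subst prod.remove[of _ j]) (auto intro!: prod.cong)
    then show ?thesis
      by (simp add: eval_poly_def p_def poly_sum poly_monom c_def mult_ac)
  qed
  ultimately show ?thesis by blast
qed

lemma eval_poly_measurable: "eval_poly n P \<in> borel_measurable (torus_measure n)"
proof -
  have [measurable]: "(\<lambda>x. x) \<in> borel_measurable circle_measure"
    by (rule continuous_on_sphere_circle_measurable) (rule continuous_on_id)
  have [measurable]: "(\<lambda>z. z j) \<in> borel_measurable (torus_measure n)" if "j < n" for j
    unfolding torus_measure_def
    by (rule measurable_compose[OF measurable_component_singleton[of j "{..<n}" "\<lambda>_. circle_measure"]])
      (use that in auto)
  show ?thesis
    unfolding eval_poly_def
    by (intro borel_measurable_sum borel_measurable_times borel_measurable_const
        borel_measurable_prod borel_measurable_power) auto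
qed

text \<open>Monomials have modulus 1 on the torus. A bound independent of \<open>z\<close> is what
  makes the truncated logarithms bounded, hence integrable.\<close>

lemma cmod_eval_poly_torus_le:
  assumes "z \<in> {..<n} \<rightarrow>\<^sub>E sphere 0 1"
  shows "cmod (eval_poly n P z) \<le> (\<Sum>\<alpha>\<in>Poly_Mapping.keys P. cmod (Poly_Mapping.lookup P \<alpha>))"
proof -
  have "cmod (\<Prod>j<n. z j ^ Poly_Mapping.lookup \<alpha> j) = 1" for \<alpha>
    using assms by (auto simp: prod_norm[symmetric] norm_power PiE_iff intro!: prod.neutral)
  then show ?thesis
    unfolding eval_poly_def by (intro sum_norm_le) (simp add: norm_mult)
qed

text \<open>The \<open>n\<close> coordinates together contribute
  \<open>2 ^ (n * deg_infty n P)\<close> after exponentiation. Since \<open>exp (ln 0) = 1\<close>,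
  a nonzero value at \<open>z\<close> is what lets \<open>exp\<close> recover the modulus.\<close>

lemma cmod_eval_poly_le_mahler_measure:
  assumes z: "z \<in> {..<n} \<rightarrow>\<^sub>E sphere 0 1" and nz: "eval_poly n P z \<noteq> 0"
  shows "cmod (eval_poly n P z) \<le> (2 ^ n) ^ deg_infty n P * mahler_measure n P"
proof -
  interpret prob_space "torus_measure n" by (rule prob_space_torus_measure)
  let ?m = "deg_infty n P" and ?F = "\<lambda>x. cmod (eval_poly n P x)"
  \<comment> \<open>Moving the constant to the left isolates a lower bound independent of
    \<open>e\<close>, as the removal of the truncation requires.\<close>
  let ?A = "ln (?F z) - real n * (real ?m * ln 2)"
  have "?A \<le> (\<integral>x. ln (?F x) \<partial>torus_measure n)"
  proof (rule le_integral_ln_of_truncated)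
    show "?F \<in> borel_measurable (torus_measure n)"
      using eval_poly_measurable by measurable
    show "?F x \<le> (\<Sum>\<alpha>\<in>Poly_Mapping.keys P. cmod (Poly_Mapping.lookup P \<alpha>))"
      if "x \<in> space (torus_measure n)" for x
      using cmod_eval_poly_torus_le that by (simp add: space_torus_measure)
    fix e :: real assume e: "0 < e"
    have "ln (?F z) \<le> ln (max (?F z) e)" using nz by (intro ln_mono) auto
    also have "\<dots> \<le> real (card {..<n}) * (real ?m * ln 2)
        + (\<integral>x. ln (max (?F x) e) \<partial>(\<Pi>\<^sub>M j\<in>{..<n}. circle_measure))"
      by (rule ln_max_le_integral_PiM[OF _ e _ cmod_eval_poly_torus_le eval_poly_fun_upd_eq_poly z])
        (use eval_poly_measurable in \<open>auto simp: torus_measure_def\<close>)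
    finally show "?A \<le> (\<integral>x. ln (max (?F x) e) \<partial>torus_measure n)"
      by (simp add: torus_measure_def)
  qed simp
  then have "exp (ln (?F z)) \<le> exp (real (n * ?m) * ln 2 + (\<integral>x. ln (?F x) \<partial>torus_measure n))"
    by (simp add: mult.assoc)
  also have "\<dots> = (2 ^ n) ^ ?m * mahler_measure n P"
    by (simp add: exp_add mahler_measure_def exp_of_nat_mult power_mult del: of_nat_mult)
  finally show ?thesis using nz by simp
qed

section \<open>From the pointwise bound to the Orlicz norm\<close>

theorem theorem4p1:
  fixes n m :: nat and P :: cpoly
  assumes "n \<ge> 1" and "P \<in> polys n" and "m = deg_infty n P" and "m \<ge> 1"
  shows "orlicz_psi_norm (torus_measure n) (1 / real m) (eval_poly n P)
           \<le> ennreal ((2 ^ n * (exp 1 - 1)) ^ m * mahler_measure n P)"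
proof -
  interpret prob_space "torus_measure n" by (rule prob_space_torus_measure)
  define s where "s = (2 ^ n * (exp 1 - 1)) ^ m * mahler_measure n P"
  have M: "0 < mahler_measure n P" by (simp add: mahler_measure_def)
  \<comment> \<open>From \<open>exp 1 \<ge> 1 + 1 + 1 / 2\<close>.\<close>
  have e1: "3 / 2 \<le> exp (1::real) - 1"
    using exp_lower_Taylor_quadratic[of "1::real"] by simp
  have s: "0 < s" unfolding s_def using M e1 by (intro mult_pos_pos zero_less_power) auto
  \<comment> \<open>Because \<open>2 / 3 * (exp 1 - 1) \<ge> 1\<close>, inserting its
    \<open>m\<close>-th power turns the pointwise bound into \<open>(2 / 3) ^ m * s\<close>; the
    exponent \<open>1 / m\<close> later reduces \<open>(2 / 3) ^ m\<close> to
    \<open>2 / 3\<close>.\<close>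
  have le: "cmod (eval_poly n P z) / s \<le> (2 / 3) ^ m" if z: "z \<in> space (torus_measure n)" for z
  proof -
    have "cmod (eval_poly n P z) \<le> (2 ^ n) ^ m * mahler_measure n P"
      using cmod_eval_poly_le_mahler_measure[of z n P] z M assms(3)
      by (cases "eval_poly n P z = 0") (auto simp: space_torus_measure)
    also have "\<dots> = 1 * ((2 ^ n) ^ m * mahler_measure n P)" by simp
    also have "\<dots> \<le> (2 / 3 * (exp 1 - 1)) ^ m * ((2 ^ n) ^ m * mahler_measure n P)"
      by (intro mult_right_mono one_le_power) (use e1 M in auto)
    also have "\<dots> = (2 / 3) ^ m * s" by (simp only: s_def power_mult_distrib ac_simps)
    finally show ?thesis using s by (simp add: field_simps)
  qed
  have "psi (1 / real m) (cmod (eval_poly n P z) / s) \<le> 1" if z: "z \<in> space (torus_measure n)" for z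
  proof -
    have "(cmod (eval_poly n P z) / s) powr (1 / real m) \<le> ((2 / 3) ^ m) powr (1 / real m)"
      using le[OF z] s by (intro powr_mono2) auto
    also have "\<dots> = 2 / 3"
      using assms(4) by (simp add: powr_powr flip: powr_realpow)
    \<comment> \<open>\<open>ln 2\<close> is the threshold:
      \<open>exp (ln 2) - 1 = 1\<close>.\<close>
    also have "\<dots> \<le> ln 2" by (rule ln2_ge_two_thirds)
    finally have "exp ((cmod (eval_poly n P z) / s) powr (1 / real m)) \<le> exp (ln 2)"
      by (rule iffD2[OF exp_le_cancel_iff])
    then show ?thesis by (simp add: psi_def)
  qed
  then have "(\<integral>\<^sup>+z. ennreal (psi (1 / real m) (cmod (eval_poly n P z) / s)) \<partial>torus_measure n)
      \<le> (\<integral>\<^sup>+z. 1 \<partial>torus_measure n)"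
    by (intro nn_integral_mono) (simp add: ennreal_le_1)
  then have "(\<integral>\<^sup>+z. ennreal (psi (1 / real m) (cmod (eval_poly n P z) / s)) \<partial>torus_measure n) \<le> 1"
    by (simp add: emeasure_space_1)
  then show ?thesis
    unfolding orlicz_psi_norm_def s_def[symmetric] using s by (intro Inf_lower) blast
qed

end
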